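(* Let $q$ be a query graph with $V(q)=\{u_0,\dots,u_{|V(q)|-1}\}$, let $G$ be a data graph, and let $(C(u))_{u\in V(q)}$ be candidate sets for $q$ in $G$. For $u,u_n\in V(q)$ and $v_n\in V(G)$ put $C^{u_n,v_n}_{u}=C(u)\cap N(v_n)$. Then the problem of Assignment under Conditional Candidate Set (ACCS) for $q$ with these candidate sets and conditional candidate sets has the same solutions as the subgraph matching problem for $(q,G)$. That is, for every assignment $u_i\mapsto v_i\in V(G)$ $(0\le i\le |V(q)|-1)$, the map $f(u_i)=v_i$ is a solution of the subgraph matching problem if and only if $(u_i,v_i)_{0\le i\le |V(q)|-1}$ is a solution of the ACCS problem.
   Context: Graphs are finite, undirected and vertex-labelled: $G=(V,E,L)$, where $L$ maps vertices to labels. $N(w)$ denotes the set of neighbours of a vertex $w$ in the graph to which $w$ belongs. Subgraph matching problem (exact, non-induced): given a query graph $q$ and a data graph $G$, a solution is a bijection $f$ from $V(q)$ onto the vertex set of a subgraph $G'$ of $G$ such that $L(u)=L(f(u))$ for all $u\in V(q)$, and $(u,u')\in E(q)$ implies $(f(u),f(u'))\in E(G')$. Equivalently, $f:V(q)\to V(G)$ is an injective, label-preserving map sending edges of $q$ to edges of $G$. Different maps count as different solutions. Candidate sets: for each $u\in V(q)$, $C(u)\subseteq V(G)$ is a set such that (i) every $v\in C(u)$ satisfies $L(v)=L(u)$, and (ii) $f(u)\in C(u)$ for every solution $f$ of the subgraph matching problem for $(q,G)$. Conditional candidate set: $C^{u_n,v_n}_{u}=C(u)\cap N(v_n)$, the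 set of candidates of $u$ given that its neighbour $u_n$ is matched to $v_n$. ACCS problem: given $q$, the candidate sets and the conditional candidate sets, a solution assigns to each $u_i\in V(q)$ a value $v_i\in C(u_i)$ such that (1) $v_i\in\bigcap_{u_n\in N(u_i)}C^{u_n,v_n}_{u_i}$ for every $i$, where $v_n$ is the value assigned to $u_n$ and an empty intersection imposes no condition, and (2) $v_i\ne v_j$ for all $i\neq j$. *)

theory Defs
  imports "Graph_Theory.Pair_Digraph" "Graph_Theory.Digraph_Component" "HOL-Library.FuncSet"
begin

record ('v, 'l) lgraph =
  skeleton :: "'v pair_pre_digraph"
  label :: "'v \<Rightarrow> 'l"

abbreviation vertices :: "('v, 'l) lgraph \<Rightarrow> 'v set" where
  "vertices G \<equiv> pverts (skeleton G)"

abbreviation edges :: "('v, 'l) lgraph \<Rightarrow> 'v rel" where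
  "edges G \<equiv> parcs (skeleton G)"

text \<open>An undirected graph is a symmetric digraph, each edge being represented by both of its
  orientations. Loops are neither required nor excluded.\<close>

definition labelled_graph :: "('v, 'l) lgraph \<Rightarrow> bool" where
  "labelled_graph G \<longleftrightarrow> pair_pseudo_graph (skeleton G)"

definition neighbours :: "('v, 'l) lgraph \<Rightarrow> 'v \<Rightarrow> 'v set" where
  "neighbours G w = {x \<in> vertices G. (w, x) \<in> edges G}"

text \<open>Vertices of a subgraph \<open>H\<close> of \<open>G\<close> carry the labels they have in \<open>G\<close>, so \<open>H\<close> is
  given by its vertices and (undirected) edges alone.\<close>

definition subgraph_matching :: "('u, 'l) lgraph \<Rightarrow> ('v, 'l) lgraph \<Rightarrow> ('u \<Rightarrow> 'v) \<Rightarrow> bool" where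
  "subgraph_matching q G f \<longleftrightarrow>
     (\<exists>H. pair_pseudo_graph H \<and> subgraph (with_proj H) (with_proj (skeleton G)) \<and>
        bij_betw f (vertices q) (pverts H) \<and>
        (\<forall>u \<in> vertices q. label q u = label G (f u)) \<and>
        (\<forall>u \<in> vertices q. \<forall>u' \<in> vertices q. (u, u') \<in> edges q \<longrightarrow> (f u, f u') \<in> parcs H))"

definition candidate_sets :: "('u, 'l) lgraph \<Rightarrow> ('v, 'l) lgraph \<Rightarrow> ('u \<Rightarrow> 'v set) \<Rightarrow> bool" where
  "candidate_sets q G C \<longleftrightarrow>
     (\<forall>u \<in> vertices q. C u \<subseteq> vertices G \<and>
        (\<forall>v \<in> C u. label G v = label q u) \<and>
        (\<forall>f. subgraph_matching q G f \<longrightarrow> f u \<in> C u))"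

definition cond_cand :: "('v, 'l) lgraph \<Rightarrow> ('u \<Rightarrow> 'v set) \<Rightarrow> 'u \<Rightarrow> 'v \<Rightarrow> 'u \<Rightarrow> 'v set" where
  "cond_cand G C u\<^sub>n v\<^sub>n u = C u \<inter> neighbours G v\<^sub>n"

text \<open>The data of an ACCS instance are the query graph, the candidate sets \<open>C\<close> and the conditional
  candidate sets \<open>CC u\<^sub>n v\<^sub>n u\<close>; the data graph is not part of it. The intersection over an empty
  set of neighbours is \<^const>\<open>UNIV\<close>.\<close>

definition ACCS_solution ::
  "('u, 'l) lgraph \<Rightarrow> ('u \<Rightarrow> 'v set) \<Rightarrow> ('u \<Rightarrow> 'v \<Rightarrow> 'u \<Rightarrow> 'v set) \<Rightarrow> ('u \<Rightarrow> 'v) \<Rightarrow> bool" where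
  "ACCS_solution q C CC f \<longleftrightarrow>
     (\<forall>u \<in> vertices q. f u \<in> C u) \<and>
     (\<forall>u \<in> vertices q. f u \<in> (\<Inter>u\<^sub>n \<in> neighbours q u. CC u\<^sub>n (f u\<^sub>n) u)) \<and>
     (\<forall>u \<in> vertices q. \<forall>u' \<in> vertices q. u \<noteq> u' \<longrightarrow> f u \<noteq> f u')"

end

theory Submission
  imports Defs
begin

text \<open>Once the witnessing subgraph is eliminated (\<open>subgraph_matching_iff\<close>), a
  matching is an injective map into \<open>G\<close> that preserves labels and edges, and this
  agrees with ACCS condition by condition. Injectivity is distinctness of the assigned values.
  Candidate sets contain the values of every matching, and their members carry the right label, so
  labels come back from membership. As \<open>cond_cand\<close> cuts \<open>C u\<close> down to the
  neighbours of the value of an adjacent vertex, the intersection condition says that edges of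
  \<open>q\<close> go to edges of \<open>G\<close>, up to orientation.\<close>

text \<open>Finiteness of the arc set is left out on the right because it follows from that of the
  vertex set.\<close>

lemma pair_pseudo_graph_iff:
  "pair_pseudo_graph H \<longleftrightarrow>
     finite (pverts H) \<and> parcs H \<subseteq> pverts H \<times> pverts H \<and> sym (parcs H)"
proof
  assume "pair_pseudo_graph H"
  then interpret pair_pseudo_graph H .
  show "finite (pverts H) \<and> parcs H \<subseteq> pverts H \<times> pverts H \<and> sym (parcs H)"
    using pair_finite_verts pair_sym_arcs by (auto simp: symmetric_def wellformed')
next
  assume H: "finite (pverts H) \<and> parcs H \<subseteq> pverts H \<times> pverts H \<and> sym (parcs H)"
  then have "finite (parcs H)"
    by (meson finite_SigmaI finite_subset)
  with H show "pair_pseudo_graph H"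
    by unfold_locales (auto simp: symmetric_def)
qed

text \<open>Arcs of a subgraph are arcs of \<open>G\<close>; conversely, arcs of \<open>G\<close>
  between image points survive in the subgraph induced on the image, which is finite because
  \<open>q\<close> is and symmetric because \<open>G\<close> is.\<close>

lemma subgraph_matching_iff:
  assumes "labelled_graph q" and "labelled_graph G"
  shows "subgraph_matching q G f \<longleftrightarrow>
    f ` vertices q \<subseteq> vertices G \<and> inj_on f (vertices q) \<and>
    (\<forall>u \<in> vertices q. label q u = label G (f u)) \<and>
    (\<forall>u \<in> vertices q. \<forall>u' \<in> vertices q. (u, u') \<in> edges q \<longrightarrow> (f u, f u') \<in> edges G)"
    (is "_ \<longleftrightarrow> ?R")
proof
  assume "subgraph_matching q G f"
  then show ?R
    unfolding subgraph_matching_def subgraph_def bij_betw_def by auto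
next
  assume R: ?R
  \<comment> \<open>The subgraph of \<open>G\<close> induced on the image of \<open>f\<close> serves as \<open>H\<close>.\<close>
  let ?V = "f ` vertices q"
  let ?H = "\<lparr>pverts = ?V, parcs = edges G \<inter> ?V \<times> ?V\<rparr> :: _ pair_pre_digraph"
  have q: "finite (vertices q)" and G: "pair_pseudo_graph (skeleton G)"
    using assms by (auto simp: labelled_graph_def pair_pseudo_graph_iff)
  have H: "pair_pseudo_graph ?H"
    using q G by (auto simp: pair_pseudo_graph_iff sym_def)
  have "subgraph (with_proj ?H) (with_proj (skeleton G))"
    using R G H
    by (auto simp: subgraph_def compatible_def wf_digraph_wp_iff
        pair_pseudo_graph_def pair_fin_digraph_def)
  moreover have "bij_betw f (vertices q) (pverts ?H)"
    using R by (simp add: bij_betw_def)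
  moreover have "\<forall>u \<in> vertices q. \<forall>u' \<in> vertices q. (u, u') \<in> edges q \<longrightarrow> (f u, f u') \<in> parcs ?H"
    using R by auto
  ultimately show "subgraph_matching q G f"
    using R H unfolding subgraph_matching_def by blast
qed

theorem mainTheorem1:
  fixes q :: "('u, 'l) lgraph"
    and G :: "('v, 'l) lgraph"
    and C :: "'u \<Rightarrow> 'v set"
    and f :: "'u \<Rightarrow> 'v"
  assumes "labelled_graph q"
    and "labelled_graph G"
    and "candidate_sets q G C"
    and "f \<in> vertices q \<rightarrow> vertices G"
  shows "subgraph_matching q G f \<longleftrightarrow> ACCS_solution q C (cond_cand G C) f"
proof
  have sym: "sym (edges q)" "sym (edges G)"
    using assms(1,2) by (auto simp: labelled_graph_def pair_pseudo_graph_iff)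
  note iff = subgraph_matching_iff[OF assms(1,2)]
  {
    assume f: "subgraph_matching q G f"
    \<comment> \<open>Completeness of the candidate sets, applied to the solution \<open>f\<close>
      itself.\<close>
    then have C: "f u \<in> C u" if "u \<in> vertices q" for u
      using assms(3) that by (auto simp: candidate_sets_def)
    have "f u \<in> cond_cand G C w (f w) u" if "u \<in> vertices q" "w \<in> neighbours q u" for u w
    proof -
      \<comment> \<open>\<open>cond_cand\<close> asks for an arc of \<open>G\<close> leaving
        \<open>f w\<close>, so the edge of \<open>q\<close> is reversed before \<open>f\<close> is
        applied.\<close>
      have "w \<in> vertices q" "(w, u) \<in> edges q"
        using that sym(1) by (auto simp: neighbours_def dest: symD)
      then show ?thesis
        using f C that(1) by (auto simp: iff cond_cand_def neighbours_def)
    qed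
    then show "ACCS_solution q C (cond_cand G C) f"
      using f C by (auto simp: iff ACCS_solution_def dest: inj_onD)
  next
    assume f: "ACCS_solution q C (cond_cand G C) f"
    have "(f u, f w) \<in> edges G"
      if "u \<in> vertices q" "w \<in> vertices q" "(u, w) \<in> edges q" for u w
    proof -
      have "w \<in> neighbours q u"
        using that by (simp add: neighbours_def)
      then have "f u \<in> cond_cand G C w (f w) u"
        using f that(1) unfolding ACCS_solution_def by blast
      \<comment> \<open>Membership yields the arc from \<open>f w\<close> to \<open>f u\<close>;
        symmetry of \<open>G\<close> turns it around.\<close>
      then show ?thesis
        using sym(2) by (auto simp: cond_cand_def neighbours_def dest: symD)
    qed
    moreover have "label q u = label G (f u)" if "u \<in> vertices q" for u
      using f assms(3) that by (simp add: ACCS_solution_def candidate_sets_def)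
    moreover have "inj_on f (vertices q)"
      using f unfolding ACCS_solution_def inj_on_def by blast
    ultimately show "subgraph_matching q G f"
      using assms(4) by (auto simp: iff)
  }
qed

end
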